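(* Let $X\subseteq\mathbb{R}^n$ be open, let $\bar x\in X$, let $J$ be a nonempty finite index set, and let $g:X\to\mathbb{R}$ be given by $g(x)=\max_{j\in J} g_j(x)$, where $g_j\in C^1(X)$ for all $j\in J$. Then $$\bigcup_{D\in\mathcal{D}(\bar x)}\operatorname{conv}\{\nabla g_j(\bar x)\mid j\in D\}\ =\ \bigcup_{\substack{p\in \mathcal{S}\\ g'(\bar x;p)>0}}\ \operatorname*{Arg\,max}_{v\in\partial g(\bar x)}\langle v,p\rangle\ \subseteq\ \operatorname*{Lim\,sup}_{\substack{x\to\bar x\\ g(x)>g(\bar x)}}\partial g(x).$$ Moreover, when all the functions $g_j$, $j\in J$, are affine, the inclusion above is an equality.
   Context: $\mathbb{R}^n$ carries the standard scalar product $\langle\cdot,\cdot\rangle$ and Euclidean norm $\|\cdot\|$; $\mathcal{S}$ is the unit sphere; $\operatorname{conv}$ denotes the convex hull (with $\operatorname{conv}\emptyset=\emptyset$). $J(\bar x)=\{j\in J\mid g_j(\bar x)=g(\bar x)\}$ is the active index set. $\mathcal{D}(\bar x)$ is the collection of all index subsets $D\subseteq J(\bar x)$ for which there exists $d\in\mathbb{R}^n$ satisfying $$\langle\nabla g_j(\bar x),d\rangle=1\ \ (j\in D),\qquad \langle\nabla g_j(\bar x),d\rangle<1\ \ (j\in J(\bar x)\setminus D).$$ The Hadamard directional derivative of $g$ at $x$ in direction $p$ is $g'(x;p)=\lim_{t\downarrow 0,\ p'\to p}\frac{g(x+tp')-g(x)}{t}$ (it exists and is finite for the $g$ considered here). The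 Fréchet subdifferential of $g$ at $x\in X$ is $$\partial g(x)=\Big\{v\in\mathbb{R}^n\ \Big|\ \liminf_{z\to x,\ z\neq x}\frac{g(z)-g(x)-\langle v,z-x\rangle}{\|z-x\|}\ge 0\Big\}.$$ Outer limit: $\operatorname{Lim\,sup}_{x\to\bar x,\ g(x)>g(\bar x)}\partial g(x)$ is the set of all $y\in\mathbb{R}^n$ for which there exist sequences $x_k\to\bar x$ in $X$ with $g(x_k)>g(\bar x)$ and $y_k\in\partial g(x_k)$ with $y_k\to y$. *)

theory Defs
  imports "HOL-Analysis.Analysis"
begin

definition gradient :: "('a::real_inner \<Rightarrow> real) \<Rightarrow> 'a \<Rightarrow> 'a" where
  "gradient f x = (THE v. GDERIV f x :> v)"

definition C1_on :: "'a::real_inner set \<Rightarrow> ('a \<Rightarrow> real) \<Rightarrow> bool" where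
  "C1_on X f \<longleftrightarrow> (\<forall>x\<in>X. f differentiable (at x)) \<and> continuous_on X (gradient f)"

text \<open>An affine function on \<open>X\<close> is the restriction to \<open>X\<close> of one affine function on the whole
  space, also when \<open>X\<close> is disconnected.\<close>

definition affine_fun_on :: "'a::real_vector set \<Rightarrow> ('a \<Rightarrow> real) \<Rightarrow> bool" where
  "affine_fun_on X f \<longleftrightarrow> (\<exists>L c. linear L \<and> (\<forall>x\<in>X. f x = L x + c))"

definition active_set ::
    "'i set \<Rightarrow> ('i \<Rightarrow> 'a \<Rightarrow> real) \<Rightarrow> ('a \<Rightarrow> real) \<Rightarrow> 'a \<Rightarrow> 'i set" where
  "active_set J gs g x = {j \<in> J. gs j x = g x}"

definition D_family ::
    "'i set \<Rightarrow> ('i \<Rightarrow> 'a::real_inner \<Rightarrow> real) \<Rightarrow> ('a \<Rightarrow> real) \<Rightarrow> 'a \<Rightarrow> 'i set set" where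
  "D_family J gs g x =
     {D. D \<subseteq> active_set J gs g x \<and>
         (\<exists>d. (\<forall>j\<in>D. gradient (gs j) x \<bullet> d = 1) \<and>
              (\<forall>j\<in>active_set J gs g x - D. gradient (gs j) x \<bullet> d < 1))}"

text \<open>The limit is taken jointly in \<open>t \<down> 0\<close> and \<open>p' \<rightarrow> p\<close>; as usual \<open>p' = p\<close> is allowed.\<close>

definition hadamard_deriv :: "('a::real_normed_vector \<Rightarrow> real) \<Rightarrow> 'a \<Rightarrow> 'a \<Rightarrow> real" where
  "hadamard_deriv g x p =
     Lim (at_right 0 \<times>\<^sub>F nhds p) (\<lambda>(t, p'). (g (x + t *\<^sub>R p') - g x) / t)"

text \<open>The lower limit is taken in the extended reals, since it may be infinite.\<close>

definition frechet_subdiff ::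
    "'a::real_inner set \<Rightarrow> ('a \<Rightarrow> real) \<Rightarrow> 'a \<Rightarrow> 'a set" where
  "frechet_subdiff X g x =
     {v. 0 \<le> Liminf (at x within X)
               (\<lambda>z. ereal ((g z - g x - v \<bullet> (z - x)) / norm (z - x)))}"

definition outer_limit_subdiff ::
    "'a::real_inner set \<Rightarrow> ('a \<Rightarrow> real) \<Rightarrow> 'a \<Rightarrow> 'a set" where
  "outer_limit_subdiff X g xbar =
     {y. \<exists>xs ys. (\<forall>k::nat. xs k \<in> X \<and> g (xs k) > g xbar \<and> ys k \<in> frechet_subdiff X g (xs k)) \<and>
                 xs \<longlonglongrightarrow> xbar \<and> ys \<longlonglongrightarrow> y}"

definition Arg_max_set :: "('a \<Rightarrow> real) \<Rightarrow> 'a set \<Rightarrow> 'a set" where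
  "Arg_max_set f A = {v. is_arg_max f (\<lambda>w. w \<in> A) v}"

end

theory Submission
  imports Defs
begin

text \<open>Near a point only the active functions matter, so the Hadamard derivative of \<open>g\<close> is the maximum of
  the linear forms given by the active gradients, and, by separation, the Frechet subdifferential is
  the convex hull of the active gradients. Its face exposed by a direction \<open>p\<close> with derivative
  \<open>m > 0\<close> is spanned by the gradients with \<open>\<langle>\<nabla>g\<^sub>j, p\<rangle> = m\<close>; rescaling \<open>d = p/m\<close> gives the first equality.
  A subgradient in such a face is a limit of subgradients at points with larger values by a
  penalised minimisation near \<open>xbar + t *\<^sub>R p\<close>. In the affine case the union over \<open>D\<close> is a finite union of
  compact sets, hence closed, and it contains the subdifferential at every nearby \<open>x\<close> with
  \<open>g x > g xbar\<close>: take \<open>d = (x - xbar) / (g x - g xbar)\<close> and \<open>D\<close> the set active at \<open>x\<close>.\<close>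

section \<open>Gradients and an epsilon form of Frechet subgradients\<close>

text \<open>The derivative is a linear functional and is represented by the vector
  \<open>adjoint f' 1\<close>. Since \<open>gradient\<close> is a definite description, uniqueness
  of this vector has to be shown as well.\<close>

lemma GDERIV_gradient:
  fixes f :: "'a::euclidean_space \<Rightarrow> real"
  assumes "f differentiable (at x)"
  shows "GDERIV f x :> gradient f x"
proof -
  obtain f' where f': "(f has_derivative f') (at x)"
    using assms by (auto simp: differentiable_def)
  have "linear f'"
    using f' has_derivative_linear by blast
  then have "f' = (\<lambda>h. h \<bullet> adjoint f' 1)"
    by (simp add: adjoint_works)
  then have ex: "GDERIV f x :> adjoint f' 1"
    using f' by (simp add: gderiv_def)
  have "v = adjoint f' 1" if "GDERIV f x :> v" for v
  proof -
    have "(\<lambda>h. h \<bullet> v) = (\<lambda>h. h \<bullet> adjoint f' 1)"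
      using that ex has_derivative_unique unfolding gderiv_def by blast
    then show ?thesis
      unfolding fun_eq_iff vector_eq_ldot .
  qed
  then show ?thesis
    unfolding gradient_def by (rule theI[of "\<lambda>v. GDERIV f x :> v", OF ex])
qed

lemma GDERIV_eventually_near:
  fixes f :: "'a::real_inner \<Rightarrow> real"
  assumes "GDERIV f x :> v" "e > 0"
  shows "\<forall>\<^sub>F z in nhds x. \<bar>f z - f x - v \<bullet> (z - x)\<bar> \<le> e * norm (z - x)"
  using assms unfolding gderiv_def has_derivative_at_alt eventually_nhds_metric
  by (simp add: dist_norm inner_commute)

text \<open>Multiplying the quotient by \<open>norm (z - x)\<close> makes the inequality trivial at
  \<open>z = x\<close>. The punctured filter can therefore be replaced by \<open>nhds x\<close>,
  which composes with limits such as \<open>x + t *\<^sub>R p'\<close> even if these hit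
  \<open>x\<close>.\<close>

lemma frechet_subdiff_iff:
  assumes "open X" "x \<in> X"
  shows "v \<in> frechet_subdiff X g x \<longleftrightarrow>
    (\<forall>e>0. \<forall>\<^sub>F z in nhds x. g x + v \<bullet> (z - x) - e * norm (z - x) \<le> g z)"
proof -
  have at: "at x within X = at x"
    using assms at_within_open by blast
  have nhds: "(\<forall>\<^sub>F z in nhds x. g x + v \<bullet> (z - x) - e * norm (z - x) \<le> g z) \<longleftrightarrow>
      (\<forall>\<^sub>F z in at x. - e \<le> (g z - g x - v \<bullet> (z - x)) / norm (z - x))" for e
    unfolding eventually_nhds_conv_at
    by (auto simp: eventually_at_filter field_simps elim!: eventually_mono)
  show ?thesis
    unfolding frechet_subdiff_def mem_Collect_eq at nhds le_Liminf_iff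
  proof (intro iffI allI impI)
    fix e :: real
    assume *: "\<forall>y<0. \<forall>\<^sub>F z in at x. y < ereal ((g z - g x - v \<bullet> (z - x)) / norm (z - x))" and "e > 0"
    then have "\<forall>\<^sub>F z in at x. ereal (- e) < ereal ((g z - g x - v \<bullet> (z - x)) / norm (z - x))"
      by (intro *[rule_format]) auto
    then show "\<forall>\<^sub>F z in at x. - e \<le> (g z - g x - v \<bullet> (z - x)) / norm (z - x)"
      by (rule eventually_mono) auto
  next
    fix y :: ereal
    assume *: "\<forall>e>0. \<forall>\<^sub>F z in at x. - e \<le> (g z - g x - v \<bullet> (z - x)) / norm (z - x)" and "y < 0"
    then obtain e where e: "y < ereal e" "e < 0"
      by (metis ereal_dense2 zero_ereal_def ereal_less(2) less_ereal.simps(1))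
    then have "\<forall>\<^sub>F z in at x. - (- e) \<le> (g z - g x - v \<bullet> (z - x)) / norm (z - x)"
      by (intro *[rule_format]) auto
    then show "\<forall>\<^sub>F z in at x. y < ereal ((g z - g x - v \<bullet> (z - x)) / norm (z - x))"
      by (rule eventually_mono) (use e in \<open>auto intro: less_le_trans\<close>)
  qed
qed

lemma convex_frechet_subdiff:
  assumes "open X" "x \<in> X"
  shows "convex (frechet_subdiff X g x)"
proof (rule convexI)
  fix v w :: 'a and a b :: real
  assume v: "v \<in> frechet_subdiff X g x" and w: "w \<in> frechet_subdiff X g x"
    and ab: "0 \<le> a" "0 \<le> b" "a + b = 1"
  show "a *\<^sub>R v + b *\<^sub>R w \<in> frechet_subdiff X g x"
    unfolding frechet_subdiff_iff[OF assms]
  proof (intro allI impI)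
    fix e :: real
    assume "e > 0"
    then have "\<forall>\<^sub>F z in nhds x. g x + v \<bullet> (z - x) - e * norm (z - x) \<le> g z"
      "\<forall>\<^sub>F z in nhds x. g x + w \<bullet> (z - x) - e * norm (z - x) \<le> g z"
      using v w unfolding frechet_subdiff_iff[OF assms] by blast+
    then show "\<forall>\<^sub>F z in nhds x. g x + (a *\<^sub>R v + b *\<^sub>R w) \<bullet> (z - x) - e * norm (z - x) \<le> g z"
    proof eventually_elim
      case (elim z)
      then have "a * (g x + v \<bullet> (z - x) - e * norm (z - x)) + b * (g x + w \<bullet> (z - x) - e * norm (z - x))
          \<le> a * g z + b * g z"
        using ab by (intro add_mono mult_left_mono) auto
      moreover have b: "b = 1 - a"
        using ab by simp
      ultimately show ?case
        unfolding b by (simp add: algebra_simps)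
    qed
  qed
qed

section \<open>Difference quotients along the Hadamard filter\<close>

lemma hadamard_filter_nontrivial: "at_right (0::real) \<times>\<^sub>F nhds p \<noteq> bot"
  by (simp add: prod_filter_eq_bot)

lemma tendsto_fst_hadamard: "(fst \<longlongrightarrow> (0::real)) (at_right 0 \<times>\<^sub>F nhds p)"
  by (rule filterlim_mono[OF filterlim_fst at_within_le_nhds order_refl])

lemma tendsto_snd_hadamard: "(snd \<longlongrightarrow> p) (at_right (0::real) \<times>\<^sub>F nhds p)"
  by (rule filterlim_snd)

lemma tendsto_hadamard_point:
  fixes x :: "'a::real_normed_vector"
  shows "((\<lambda>u. x + fst u *\<^sub>R snd u) \<longlongrightarrow> x) (at_right 0 \<times>\<^sub>F nhds p)"
proof -
  have "((\<lambda>u. x + fst u *\<^sub>R snd u) \<longlongrightarrow> x + 0 *\<^sub>R p) (at_right 0 \<times>\<^sub>F nhds p)"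
    by (intro tendsto_intros tendsto_fst_hadamard tendsto_snd_hadamard)
  then show ?thesis by simp
qed

lemma eventually_fst_pos_hadamard: "\<forall>\<^sub>F u in at_right (0::real) \<times>\<^sub>F nhds p. fst u > 0"
  by (rule eventually_compose_filterlim[OF _ filterlim_fst]) (simp add: eventually_at_right_less)

text \<open>The first-order error at \<open>x + t *\<^sub>R p'\<close> is at most a small multiple
  of \<open>t * norm p'\<close>. Division by \<open>t\<close> leaves a small multiple of
  \<open>norm p'\<close>, which is bounded for \<open>p'\<close> near \<open>p\<close>.\<close>

lemma hadamard_quotient_tendsto_gradient:
  fixes f :: "'a::real_inner \<Rightarrow> real"
  assumes "GDERIV f x :> v"
  shows "((\<lambda>u. (f (x + fst u *\<^sub>R snd u) - f x) / fst u) \<longlongrightarrow> v \<bullet> p) (at_right 0 \<times>\<^sub>F nhds p)"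
proof -
  let ?F = "at_right (0::real) \<times>\<^sub>F nhds p"
  let ?q = "\<lambda>u. (f (x + fst u *\<^sub>R snd u) - f x) / fst u"
  have "((\<lambda>u. ?q u - v \<bullet> snd u) \<longlongrightarrow> 0) ?F"
  proof (rule tendstoI)
    fix e :: real
    assume "e > 0"
    \<comment> \<open>Chosen so that \<open>d * (norm p + 1) = e\<close>. The summand 1 leaves room
      for \<open>p'\<close> near \<open>p\<close> and covers \<open>p = 0\<close>.\<close>
    define d where "d = e / (norm p + 1)"
    have "d > 0"
      using \<open>e > 0\<close> by (simp add: d_def add_nonneg_pos)
    have 1: "\<forall>\<^sub>F u in ?F. \<bar>f (x + fst u *\<^sub>R snd u) - f x - v \<bullet> (x + fst u *\<^sub>R snd u - x)\<bar>
        \<le> d * norm (x + fst u *\<^sub>R snd u - x)"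
      by (rule eventually_compose_filterlim[OF GDERIV_eventually_near[OF assms \<open>d > 0\<close>]
            tendsto_hadamard_point])
    have 2: "\<forall>\<^sub>F u in ?F. norm (snd u) < norm p + 1"
      by (rule order_tendstoD(2)[OF tendsto_norm[OF tendsto_snd_hadamard]]) simp
    show "\<forall>\<^sub>F u in ?F. dist (?q u - v \<bullet> snd u) 0 < e"
      using 1 2 eventually_fst_pos_hadamard[of p]
    proof eventually_elim
      case (elim u)
      have "?q u - v \<bullet> snd u = (f (x + fst u *\<^sub>R snd u) - f x - v \<bullet> (fst u *\<^sub>R snd u)) / fst u"
        using elim by (simp add: field_simps)
      then have "\<bar>?q u - v \<bullet> snd u\<bar> \<le> d * norm (snd u)"
        using elim by (simp add: divide_le_eq mult_ac)
      also have "\<dots> < d * (norm p + 1)"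
        using elim \<open>d > 0\<close> by simp
      also have "\<dots> = e"
        by (simp add: d_def add_nonneg_eq_0_iff)
      finally show ?case by simp
    qed
  qed
  then have "((\<lambda>u. ?q u - v \<bullet> snd u + v \<bullet> snd u) \<longlongrightarrow> 0 + v \<bullet> p) ?F"
    by (intro tendsto_add tendsto_inner tendsto_const tendsto_snd_hadamard)
  then show ?thesis by simp
qed

lemma tendsto_Max_image:
  fixes f :: "'i \<Rightarrow> 'b \<Rightarrow> 'c::linorder_topology"
  assumes "finite A" "A \<noteq> {}" "\<And>i. i \<in> A \<Longrightarrow> (f i \<longlongrightarrow> l i) F"
  shows "((\<lambda>x. Max ((\<lambda>i. f i x) ` A)) \<longlongrightarrow> Max (l ` A)) F"
  using assms
proof (induction A rule: finite_ne_induct)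
  case (insert i A)
  then show ?case
    by (simp add: tendsto_max)
qed simp

text \<open>The subgradient inequality at \<open>x + t *\<^sub>R p'\<close>, divided by
  \<open>t\<close>, passes to the limit up to an error \<open>e * norm p\<close>, and
  \<open>e\<close> is arbitrary.\<close>

lemma frechet_subgradient_le_hadamard_limit:
  assumes "open X" "x \<in> X" "v \<in> frechet_subdiff X g x"
    and lim: "((\<lambda>u. (g (x + fst u *\<^sub>R snd u) - g x) / fst u) \<longlongrightarrow> l) (at_right 0 \<times>\<^sub>F nhds p)"
  shows "v \<bullet> p \<le> l"
proof -
  let ?F = "at_right (0::real) \<times>\<^sub>F nhds p"
  have *: "v \<bullet> p - e * norm p \<le> l" if "e > 0" for e
  proof (rule tendsto_le[OF hadamard_filter_nontrivial lim])
    show "((\<lambda>u. v \<bullet> snd u - e * norm (snd u)) \<longlongrightarrow> v \<bullet> p - e * norm p) ?F"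
      by (intro tendsto_intros tendsto_snd_hadamard)
    have "\<forall>\<^sub>F z in nhds x. g x + v \<bullet> (z - x) - e * norm (z - x) \<le> g z"
      using assms(3) that frechet_subdiff_iff[OF assms(1,2)] by blast
    from eventually_compose_filterlim[OF this tendsto_hadamard_point] eventually_fst_pos_hadamard[of p]
    show "\<forall>\<^sub>F u in ?F. v \<bullet> snd u - e * norm (snd u) \<le> (g (x + fst u *\<^sub>R snd u) - g x) / fst u"
      by eventually_elim (simp add: field_simps)
  qed
  show ?thesis
  proof (rule field_le_epsilon)
    fix e :: real
    assume "e > 0"
    then have "e / (norm p + 1) * norm p \<le> e"
      by (simp add: divide_le_eq add_nonneg_pos distrib_left)
    moreover have "v \<bullet> p - e / (norm p + 1) * norm p \<le> l"
      using \<open>e > 0\<close> by (intro *) (simp add: add_nonneg_pos)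
    ultimately show "v \<bullet> p \<le> l + e"
      by linarith
  qed
qed

section \<open>Subgradients at nearby points with larger values\<close>

text \<open>Near \<open>xbar + t *\<^sub>R p\<close>, minimise \<open>g - \<langle>y, \<cdot>\<rangle>\<close> plus a quadratic penalty of weight \<open>1/t\<close>. Since \<open>y\<close>
  is a subgradient whose first-order lower bound is tight along \<open>p\<close>, the minimiser stays
  \<open>o(t)\<close>-close to \<open>xbar + t *\<^sub>R p\<close>, and the optimality condition there yields a subgradient close
  to \<open>y\<close>.\<close>

lemma exists_subgradient_near_tight_direction:
  fixes g :: "'a::euclidean_space \<Rightarrow> real"
  assumes X: "open X" "xbar \<in> X" and cont: "continuous_on X g"
    and y: "y \<in> frechet_subdiff X g xbar"
    and lim: "((\<lambda>u. (g (xbar + fst u *\<^sub>R snd u) - g xbar) / fst u) \<longlongrightarrow> y \<bullet> p) (at_right 0 \<times>\<^sub>F nhds p)"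
    and pos: "y \<bullet> p > 0" and "e > 0"
  shows "\<exists>z v. z \<in> X \<and> g z > g xbar \<and> v \<in> frechet_subdiff X g z \<and> dist z xbar < e \<and> dist v y < e"
proof -
  let ?q = "\<lambda>u. (g (xbar + fst u *\<^sub>R snd u) - g xbar) / fst u"
  have "\<forall>\<^sub>F u in at_right 0 \<times>\<^sub>F nhds p. ?q u > 0"
    using lim pos by (rule order_tendstoD)
  \<comment> \<open>Because the limit is joint in \<open>t\<close> and \<open>p'\<close>, one
    threshold on \<open>t\<close> works for a whole neighbourhood of directions. This later gives
    \<open>g z > g xbar\<close> at a point \<open>z\<close> not lying on the ray along
    \<open>p\<close>.\<close>
  then obtain P Q where P: "eventually P (at_right 0)" and Q: "eventually Q (nhds p)"
    and PQ: "\<And>t p'. P t \<Longrightarrow> Q p' \<Longrightarrow> ?q (t, p') > 0"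
    unfolding eventually_prod_filter by blast
  obtain r0 where r0: "r0 > 0" "\<And>p'. dist p' p < r0 \<Longrightarrow> Q p'"
    using Q unfolding eventually_nhds_metric by blast
  \<comment> \<open>The bound \<open>r0\<close> keeps perturbed directions inside \<open>Q\<close>;
    the bound \<open>e / 2\<close> is for the final estimate
    \<open>dist v y < 2 * r\<close>.\<close>
  define r where "r = min r0 (e / 2)"
  have r: "r > 0" "r \<le> r0" "2 * r \<le> e"
    using r0 \<open>e > 0\<close> by (auto simp: r_def)
  \<comment> \<open>With this value the Frechet error of \<open>y\<close> on the ball of radius
    \<open>t * r\<close> around \<open>xbar + t *\<^sub>R p\<close> is at most
    \<open>t * r\<^sup>2 / 4\<close>.\<close>
  define \<eta> where "\<eta> = r\<^sup>2 / (4 * (norm p + r))"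
  have pr: "norm p + r > 0"
    using r by (simp add: add_nonneg_pos)
  have \<eta>: "\<eta> > 0" "\<eta> * (norm p + r) = r\<^sup>2 / 4"
    using pr r by (simp_all add: \<eta>_def del: distrib_left_numeral)
  have "\<forall>\<^sub>F z in nhds xbar. g xbar + y \<bullet> (z - xbar) - \<eta> * norm (z - xbar) \<le> g z"
    using y \<eta> frechet_subdiff_iff[OF X] by blast
  moreover have "\<forall>\<^sub>F z in nhds xbar. z \<in> X"
    using X by (rule eventually_nhds_in_open)
  ultimately have "\<forall>\<^sub>F z in nhds xbar. z \<in> X \<and> g xbar + y \<bullet> (z - xbar) - \<eta> * norm (z - xbar) \<le> g z"
    by eventually_elim simp
  then obtain \<delta> where \<delta>: "\<delta> > 0" "\<And>z. dist z xbar < \<delta> \<Longrightarrow> z \<in> X"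
    "\<And>z. dist z xbar < \<delta> \<Longrightarrow> g xbar + y \<bullet> (z - xbar) - \<eta> * norm (z - xbar) \<le> g z"
    unfolding eventually_nhds_metric by blast
  have "filterlim (\<lambda>t. (t, p)) (at_right 0 \<times>\<^sub>F nhds p) (at_right (0::real))"
    by (intro filterlim_Pair filterlim_ident tendsto_const)
  from filterlim_compose[OF lim this]
  have "((\<lambda>t. ?q (t, p)) \<longlongrightarrow> y \<bullet> p) (at_right 0)" .
  \<comment> \<open>Tightness along \<open>p\<close> bounds \<open>g\<close> at the centre from
    above, with a second error of \<open>t * r\<^sup>2 / 4\<close>.\<close>
  then have ub: "\<forall>\<^sub>F t in at_right 0. ?q (t, p) < y \<bullet> p + r\<^sup>2 / 4"
    by (rule order_tendstoD) (use r in simp)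
  have small: "\<forall>\<^sub>F t in at_right (0::real). t * (norm p + r) < min \<delta> e"
  proof -
    have "((\<lambda>t. t * (norm p + r)) \<longlongrightarrow> 0 * (norm p + r)) (at_right 0)"
      by (intro tendsto_intros)
    then show ?thesis
      by (rule order_tendstoD) (use \<delta> \<open>e > 0\<close> in simp)
  qed
  have "\<forall>\<^sub>F t in at_right (0::real). t > 0"
    by (simp add: eventually_at_right_less)
  with P ub small
  have "\<forall>\<^sub>F t in at_right 0. P t \<and> ?q (t, p) < y \<bullet> p + r\<^sup>2 / 4 \<and> t * (norm p + r) < min \<delta> e \<and> t > 0"
    by eventually_elim simp
  then obtain t where "P t" and qt: "?q (t, p) < y \<bullet> p + r\<^sup>2 / 4"
    and ts: "t * (norm p + r) < min \<delta> e" and "t > 0"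
    using eventually_happens[of _ "at_right (0::real)"] by auto
  define c where "c = xbar + t *\<^sub>R p"
  define \<psi> where "\<psi> z = g z - y \<bullet> z + (norm (z - c))\<^sup>2 / t" for z
  have near: "norm (z - xbar) \<le> t * (norm p + r)" if "z \<in> cball c (t * r)" for z
  proof -
    have "norm (z - xbar) \<le> norm (z - c) + norm (t *\<^sub>R p)"
      using norm_triangle_ineq[of "z - c" "t *\<^sub>R p"] by (simp add: c_def)
    also have "\<dots> \<le> t * r + t * norm p"
      using that \<open>t > 0\<close> by (simp add: dist_norm norm_minus_commute)
    finally show ?thesis by (simp add: algebra_simps)
  qed
  have sub: "dist z xbar < \<delta>" if "z \<in> cball c (t * r)" for z
    using near[OF that] ts by (simp add: dist_norm)
  have "continuous_on (cball c (t * r)) g"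
    using cont by (rule continuous_on_subset) (use sub \<delta> in blast)
  then have "continuous_on (cball c (t * r)) \<psi>"
    unfolding \<psi>_def using \<open>t > 0\<close> by (intro continuous_intros) auto
  moreover have c_in: "c \<in> cball c (t * r)"
    using r \<open>t > 0\<close> by simp
  ultimately obtain z where z: "z \<in> cball c (t * r)" and zmin: "\<And>w. w \<in> cball c (t * r) \<Longrightarrow> \<psi> z \<le> \<psi> w"
    using continuous_attains_inf[of "cball c (t * r)" \<psi>] by (metis compact_cball empty_iff)
  \<comment> \<open>Comparing \<open>\<psi> z\<close> with \<open>\<psi> c\<close>, the linear terms
    cancel and only the two errors remain. They sum to \<open>t * r\<^sup>2 / 2\<close>, so
    \<open>z\<close> lies strictly inside the ball and is a local minimiser without
    constraint.\<close>
  have "g c - g xbar < t * (y \<bullet> p + r\<^sup>2 / 4)"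
    using qt \<open>t > 0\<close> by (simp add: c_def field_simps)
  moreover have "g xbar + y \<bullet> (z - xbar) - \<eta> * norm (z - xbar) \<le> g z"
    using sub[OF z] \<delta> by blast
  moreover have "\<eta> * norm (z - xbar) \<le> \<eta> * (t * (norm p + r))"
    using near[OF z] \<eta> by simp
  moreover have "\<eta> * (t * (norm p + r)) = t * (r\<^sup>2 / 4)"
    using \<eta>(2) by (metis mult.left_commute)
  moreover have "g z - y \<bullet> z + (norm (z - c))\<^sup>2 / t \<le> g c - y \<bullet> c"
    using zmin[OF c_in] by (simp add: \<psi>_def)
  moreover have "y \<bullet> c = y \<bullet> xbar + t * (y \<bullet> p)"
    by (simp add: c_def inner_add_right)
  ultimately have "(norm (z - c))\<^sup>2 / t < t * (r\<^sup>2 / 4) + t * (r\<^sup>2 / 4)"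
    by (simp add: inner_diff_right distrib_left)
  also have "\<dots> < t * r\<^sup>2"
    using \<open>t > 0\<close> r by simp
  finally have "(norm (z - c))\<^sup>2 < (t * r)\<^sup>2"
    using \<open>t > 0\<close> by (simp add: field_simps power2_eq_square)
  then have zc: "norm (z - c) < t * r"
    by (rule power_less_imp_less_base) (use \<open>t > 0\<close> r in simp)
  \<comment> \<open>Stationarity of \<open>\<psi>\<close> at \<open>z\<close>: \<open>y\<close>
    minus the gradient of the penalty.\<close>
  define v where "v = y - (2 / t) *\<^sub>R (z - c)"
  have "z \<in> X"
    using sub[OF z] \<delta> by blast
  moreover have "g z > g xbar"
  proof -
    \<comment> \<open>The direction for which \<open>xbar + t *\<^sub>R p' = z\<close>.\<close>
    define p' where "p' = p + (1 / t) *\<^sub>R (z - c)"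
    have "dist p' p = norm (z - c) / t"
      using \<open>t > 0\<close> by (simp add: p'_def dist_norm)
    also have "\<dots> < r0"
      using zc \<open>t > 0\<close> r by (simp add: divide_less_eq mult.commute less_le_trans)
    finally have "dist p' p < r0" .
    then have "?q (t, p') > 0"
      using PQ r0 \<open>P t\<close> by blast
    moreover have "xbar + t *\<^sub>R p' = z"
      using \<open>t > 0\<close> by (simp add: p'_def c_def scaleR_add_right)
    ultimately show ?thesis
      using \<open>t > 0\<close> by (simp add: zero_less_divide_iff)
  qed
  moreover have "v \<in> frechet_subdiff X g z"
    unfolding frechet_subdiff_iff[OF X(1) \<open>z \<in> X\<close>]
  proof (intro allI impI)
    fix \<epsilon> :: real
    assume "\<epsilon> > 0"
    have "z \<in> ball c (t * r)"
      using zc by (simp add: dist_norm norm_minus_commute)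
    then have "\<forall>\<^sub>F w in nhds z. w \<in> ball c (t * r)"
      by (intro eventually_nhds_in_open) auto
    moreover have "\<forall>\<^sub>F w in nhds z. dist w z < \<epsilon> * t"
      unfolding eventually_nhds_metric using \<open>\<epsilon> > 0\<close> \<open>t > 0\<close> by (metis mult_pos_pos)
    ultimately show "\<forall>\<^sub>F w in nhds z. g z + v \<bullet> (w - z) - \<epsilon> * norm (w - z) \<le> g w"
    proof eventually_elim
      case (elim w)
      have "(norm (w - c))\<^sup>2 = (norm (z - c))\<^sup>2 + 2 * ((z - c) \<bullet> (w - z)) + (norm (w - z))\<^sup>2"
        unfolding power2_norm_eq_inner by (simp add: algebra_simps inner_commute)
      then have "(norm (w - c))\<^sup>2 / t =
          (norm (z - c))\<^sup>2 / t + (2 / t) * ((z - c) \<bullet> (w - z)) + (norm (w - z))\<^sup>2 / t"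
        by (simp add: add_divide_distrib)
      \<comment> \<open>The second-order remainder of the penalty is absorbed by the Frechet error
        once \<open>w\<close> is within \<open>\<epsilon> * t\<close> of \<open>z\<close>.\<close>
      moreover have "(norm (w - z))\<^sup>2 / t \<le> \<epsilon> * norm (w - z)"
      proof -
        have "norm (w - z) * norm (w - z) \<le> (\<epsilon> * t) * norm (w - z)"
          using elim by (intro mult_right_mono) (auto simp: dist_norm)
        then show ?thesis
          using \<open>t > 0\<close> by (simp add: field_simps power2_eq_square)
      qed
      moreover have "\<psi> z \<le> \<psi> w"
        using elim zmin by simp
      moreover have "v \<bullet> (w - z) = y \<bullet> w - y \<bullet> z - (2 / t) * ((z - c) \<bullet> (w - z))"
        unfolding v_def inner_diff_left[of y] inner_scaleR_left inner_diff_right[of y] ..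
      ultimately show ?case
        unfolding \<psi>_def by linarith
    qed
  qed
  moreover have "dist z xbar < e"
    using near[OF z] ts by (simp add: dist_norm)
  moreover have "dist v y < e"
  proof -
    have "dist v y = 2 * (norm (z - c) / t)"
      using \<open>t > 0\<close> by (simp add: v_def dist_norm)
    also have "\<dots> < 2 * r"
      using zc \<open>t > 0\<close> by (simp add: field_simps)
    finally show ?thesis using r by simp
  qed
  ultimately show ?thesis by blast
qed

lemma tight_subgradient_in_outer_limit:
  fixes g :: "'a::euclidean_space \<Rightarrow> real"
  assumes "open X" "xbar \<in> X" "continuous_on X g"
    and "y \<in> frechet_subdiff X g xbar"
    and "((\<lambda>u. (g (xbar + fst u *\<^sub>R snd u) - g xbar) / fst u) \<longlongrightarrow> y \<bullet> p) (at_right 0 \<times>\<^sub>F nhds p)"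
    and "y \<bullet> p > 0"
  shows "y \<in> outer_limit_subdiff X g xbar"
proof -
  have "\<forall>k::nat. \<exists>z v. z \<in> X \<and> g z > g xbar \<and> v \<in> frechet_subdiff X g z \<and>
      dist z xbar < inverse (real (Suc k)) \<and> dist v y < inverse (real (Suc k))"
    using exists_subgradient_near_tight_direction[OF assms] by simp
  then obtain xs ys where *: "\<And>k::nat. xs k \<in> X \<and> g (xs k) > g xbar \<and> ys k \<in> frechet_subdiff X g (xs k) \<and>
      dist (xs k) xbar < inverse (real (Suc k)) \<and> dist (ys k) y < inverse (real (Suc k))"
    by metis
  have lim: "us \<longlonglongrightarrow> u" if "\<And>k. dist (us k) u < inverse (real (Suc k))" for us :: "nat \<Rightarrow> 'a" and u
    using that by (intro metric_tendsto_imp_tendsto[OF LIMSEQ_inverse_real_of_nat])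
      (auto intro!: always_eventually less_imp_le simp: dist_real_def)
  show ?thesis
    unfolding outer_limit_subdiff_def using * lim by blast
qed

section \<open>Exposed faces of a polytope\<close>

text \<open>As \<open>m\<close> is an attained upper bound, the maximisers form the face cut out by
  the supporting hyperplane at level \<open>m\<close>. A face of the hull of a finite set is the
  hull of some of its points, and these lie on the hyperplane.\<close>

lemma Arg_max_set_convex_hull:
  fixes a :: "'i \<Rightarrow> 'a::euclidean_space"
  assumes "finite A" and le: "\<And>j. j \<in> A \<Longrightarrow> a j \<bullet> p \<le> m" and ex: "\<exists>j\<in>A. a j \<bullet> p = m"
  shows "Arg_max_set (\<lambda>v. v \<bullet> p) (convex hull (a ` A)) = convex hull (a ` {j \<in> A. a j \<bullet> p = m})"
proof -
  let ?H = "convex hull (a ` A)"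
  have "?H \<subseteq> {v. p \<bullet> v \<le> m}"
    using le by (intro hull_minimal convex_halfspace_le) (auto simp: inner_commute)
  then have upper: "p \<bullet> v \<le> m" if "v \<in> ?H" for v
    using that by blast
  obtain i where "i \<in> A" "a i \<bullet> p = m"
    using ex by blast
  then have "a i \<in> ?H"
    by (simp add: hull_inc)
  have "Arg_max_set (\<lambda>v. v \<bullet> p) ?H = ?H \<inter> {v. p \<bullet> v = m}"
    unfolding Arg_max_set_def is_arg_max_def
    using upper \<open>a i \<in> ?H\<close> \<open>a i \<bullet> p = m\<close> by (force simp: inner_commute not_less)
  also have "\<dots> = convex hull (a ` {j \<in> A. a j \<bullet> p = m})"
  proof
    have "(?H \<inter> {v. p \<bullet> v = m}) face_of ?H"
      using upper by (intro face_of_Int_supporting_hyperplane_le) auto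
    then obtain S where S: "S \<subseteq> a ` A" "?H \<inter> {v. p \<bullet> v = m} = convex hull S"
      using \<open>finite A\<close> by (metis face_of_convex_hull_subset finite_imageI finite_imp_compact)
    have "S \<subseteq> {v. p \<bullet> v = m}"
      using S hull_subset[of S convex] by blast
    with S(1) have "S \<subseteq> a ` {j \<in> A. a j \<bullet> p = m}"
      by (auto simp: inner_commute[of p])
    then show "?H \<inter> {v. p \<bullet> v = m} \<subseteq> convex hull (a ` {j \<in> A. a j \<bullet> p = m})"
      unfolding S(2) by (rule hull_mono)
    show "convex hull (a ` {j \<in> A. a j \<bullet> p = m}) \<subseteq> ?H \<inter> {v. p \<bullet> v = m}"
      by (intro hull_minimal convex_Int convex_convex_hull convex_hyperplane)
        (auto simp: hull_inc inner_commute)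
  qed
  finally show ?thesis .
qed

section \<open>Finite maxima of differentiable functions\<close>

locale max_function =
  fixes X :: "'a::euclidean_space set" and J :: "'i set"
    and gs :: "'i \<Rightarrow> 'a \<Rightarrow> real" and g :: "'a \<Rightarrow> real"
  assumes open_X: "open X" and finite_J: "finite J" and J_nonempty: "J \<noteq> {}"
    and g_eq: "\<And>x. x \<in> X \<Longrightarrow> g x = Max ((\<lambda>j. gs j x) ` J)"
    and differentiable: "\<And>j x. j \<in> J \<Longrightarrow> x \<in> X \<Longrightarrow> gs j differentiable (at x)"
begin

abbreviation active :: "'a \<Rightarrow> 'i set" where
  "active x \<equiv> active_set J gs g x"

lemma active_subset: "active x \<subseteq> J"
  by (auto simp: active_set_def)

lemma finite_active: "finite (active x)"
  using active_subset finite_J by (rule finite_subset)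

lemma active_nonempty:
  assumes "x \<in> X"
  shows "active x \<noteq> {}"
proof -
  have "g x \<in> (\<lambda>j. gs j x) ` J"
    unfolding g_eq[OF assms] using finite_J J_nonempty by (intro Max_in) auto
  then show ?thesis
    by (auto simp: active_set_def)
qed

lemma gs_le_g: "j \<in> J \<Longrightarrow> x \<in> X \<Longrightarrow> gs j x \<le> g x"
  using finite_J by (simp add: g_eq)

lemma GDERIV_gs: "j \<in> J \<Longrightarrow> x \<in> X \<Longrightarrow> GDERIV (gs j) x :> gradient (gs j) x"
  by (intro GDERIV_gradient differentiable)

lemma isCont_gs: "j \<in> J \<Longrightarrow> x \<in> X \<Longrightarrow> isCont (gs j) x"
  by (simp add: differentiable differentiable_imp_continuous_within)

lemma isCont_g:
  assumes "x \<in> X"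
  shows "isCont g x"
proof -
  have "((\<lambda>z. Max ((\<lambda>j. gs j z) ` J)) \<longlongrightarrow> Max ((\<lambda>j. gs j x) ` J)) (at x)"
    using finite_J J_nonempty isCont_gs assms
    by (intro tendsto_Max_image) (auto simp: isCont_def)
  then have "((\<lambda>z. Max ((\<lambda>j. gs j z) ` J)) \<longlongrightarrow> g x) (at x)"
    by (simp add: g_eq assms)
  then show ?thesis
    unfolding isCont_def
    by (rule Lim_transform_within_open[OF _ open_X assms]) (simp add: g_eq)
qed

text \<open>The strict gap at \<open>x\<close> persists nearby by continuity, uniformly over the
  finitely many inactive indices.\<close>

lemma eventually_inactive_less:
  assumes "x \<in> X"
  shows "\<forall>\<^sub>F z in nhds x. \<forall>j\<in>J - active x. gs j z < g z"
proof (rule eventually_ball_finite, use finite_J in simp, rule ballI)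
  fix j
  assume j: "j \<in> J - active x"
  have "isCont (\<lambda>z. gs j z - g z) x"
    using j assms by (intro continuous_intros isCont_gs isCont_g) auto
  then have "((\<lambda>z. gs j z - g z) \<longlongrightarrow> gs j x - g x) (nhds x)"
    by (simp add: continuous_at_imp_continuous_at_within isCont_def tendsto_nhds_iff)
  moreover have "gs j x - g x < 0"
    using j gs_le_g[of j x] assms by (force simp: active_set_def)
  ultimately have "\<forall>\<^sub>F z in nhds x. gs j z - g z < 0"
    by (rule order_tendstoD)
  then show "\<forall>\<^sub>F z in nhds x. gs j z < g z"
    by simp
qed

lemma eventually_active_subset:
  assumes "x \<in> X"
  shows "\<forall>\<^sub>F z in nhds x. active z \<subseteq> active x"
  using eventually_inactive_less[OF assms]
  by eventually_elim (force simp: active_set_def)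

text \<open>Some index attains the maximum at \<open>z\<close>, and for \<open>z\<close> near
  \<open>x\<close> every such index is active at \<open>x\<close>.\<close>

lemma eventually_g_eq_Max_active:
  assumes "x \<in> X"
  shows "\<forall>\<^sub>F z in nhds x. g z = Max ((\<lambda>j. gs j z) ` active x)"
  using eventually_active_subset[OF assms] eventually_nhds_in_open[OF open_X assms]
proof eventually_elim
  case (elim z)
  show ?case
  proof (rule sym, rule Max_eqI)
    show "g z \<in> (\<lambda>j. gs j z) ` active x"
      using active_nonempty[of z] elim by (force simp: active_set_def)
  qed (use finite_active active_subset gs_le_g elim in \<open>auto simp: active_set_def\<close>)
qed

lemma hadamard_quotient_tendsto:
  assumes "x \<in> X"
  shows "((\<lambda>u. (g (x + fst u *\<^sub>R snd u) - g x) / fst u) \<longlongrightarrow>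
    Max ((\<lambda>j. gradient (gs j) x \<bullet> p) ` active x)) (at_right 0 \<times>\<^sub>F nhds p)"
proof -
  let ?F = "at_right (0::real) \<times>\<^sub>F nhds p"
  let ?q = "\<lambda>j u. (gs j (x + fst u *\<^sub>R snd u) - gs j x) / fst u"
  have lim: "((\<lambda>u. Max ((\<lambda>j. ?q j u) ` active x)) \<longlongrightarrow>
      Max ((\<lambda>j. gradient (gs j) x \<bullet> p) ` active x)) ?F"
    using active_subset assms
    by (intro tendsto_Max_image finite_active active_nonempty hadamard_quotient_tendsto_gradient
        GDERIV_gs) auto
  have ev: "\<forall>\<^sub>F u in ?F. Max ((\<lambda>j. ?q j u) ` active x) = (g (x + fst u *\<^sub>R snd u) - g x) / fst u"
    using eventually_compose_filterlim[OF eventually_g_eq_Max_active[OF assms] tendsto_hadamard_point]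
      eventually_fst_pos_hadamard[of p]
  proof eventually_elim
    case (elim u)
    let ?z = "x + fst u *\<^sub>R snd u"
    \<comment> \<open>For \<open>t > 0\<close> this map is increasing, so it commutes with
      \<open>Max\<close>. Active functions share the value \<open>g x\<close> at \<open>x\<close>,
      which turns the quotient of the maximum into the maximum of the quotients.\<close>
    have "mono (\<lambda>s. (s - g x) / fst u)"
      using elim by (auto intro!: monoI divide_right_mono)
    then have "(Max ((\<lambda>j. gs j ?z) ` active x) - g x) / fst u =
        Max ((\<lambda>s. (s - g x) / fst u) ` (\<lambda>j. gs j ?z) ` active x)"
      using finite_active active_nonempty[OF assms]
      by (intro mono_Max_commute[where f = "\<lambda>s. (s - g x) / fst u"]) auto
    also have "(\<lambda>s. (s - g x) / fst u) ` (\<lambda>j. gs j ?z) ` active x = (\<lambda>j. ?q j u) ` active x"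
      unfolding image_image by (intro image_cong refl) (simp add: active_set_def)
    finally show ?case
      using elim by simp
  qed
  show ?thesis
    using lim ev by (rule Lim_transform_eventually)
qed

lemma hadamard_deriv_eq_Max:
  assumes "x \<in> X"
  shows "hadamard_deriv g x p = Max ((\<lambda>j. gradient (gs j) x \<bullet> p) ` active x)"
  unfolding hadamard_deriv_def case_prod_beta
  using hadamard_filter_nontrivial hadamard_quotient_tendsto[OF assms] by (rule tendsto_Lim)

text \<open>An active \<open>gs j\<close> lies below \<open>g\<close> and touches it at
  \<open>x\<close>, so its gradient is a subgradient, and convexity gives the hull. Conversely, a
  subgradient separated from the hull would exceed the directional derivative in the separating
  direction.\<close>

lemma frechet_subdiff_eq_convex_hull:
  assumes "x \<in> X"
  shows "frechet_subdiff X g x = convex hull ((\<lambda>j. gradient (gs j) x) ` active x)"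
proof
  let ?H = "convex hull ((\<lambda>j. gradient (gs j) x) ` active x)"
  have "gradient (gs j) x \<in> frechet_subdiff X g x" if "j \<in> active x" for j
    unfolding frechet_subdiff_iff[OF open_X assms]
  proof (intro allI impI)
    fix e :: real
    assume "e > 0"
    have j: "j \<in> J" "gs j x = g x"
      using that by (auto simp: active_set_def)
    show "\<forall>\<^sub>F z in nhds x. g x + gradient (gs j) x \<bullet> (z - x) - e * norm (z - x) \<le> g z"
      using GDERIV_eventually_near[OF GDERIV_gs[OF \<open>j \<in> J\<close> assms] \<open>e > 0\<close>]
        eventually_nhds_in_open[OF open_X assms]
    proof eventually_elim
      case (elim z)
      then show ?case
        using gs_le_g[OF \<open>j \<in> J\<close>, of z] j by linarith
    qed
  qed
  then show "?H \<subseteq> frechet_subdiff X g x"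
    by (intro hull_minimal convex_frechet_subdiff open_X assms) auto
  show "frechet_subdiff X g x \<subseteq> ?H"
  proof (rule ccontr)
    assume "\<not> ?thesis"
    then obtain v where v: "v \<in> frechet_subdiff X g x" "v \<notin> ?H"
      by blast
    have "closed ?H"
      using finite_active by (intro compact_imp_closed finite_imp_compact_convex_hull) auto
    then obtain a b where ab: "a \<bullet> v < b" "\<And>w. w \<in> ?H \<Longrightarrow> a \<bullet> w > b"
      using separating_hyperplane_closed_point[of ?H v] v by auto
    \<comment> \<open>The separating vector \<open>a\<close> puts \<open>v\<close> on the lower
      side, so the contradiction arises along \<open>- a\<close>.\<close>
    have "v \<bullet> (- a) \<le> Max ((\<lambda>j. gradient (gs j) x \<bullet> (- a)) ` active x)"
      using hadamard_quotient_tendsto[OF assms]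
      by (rule frechet_subgradient_le_hadamard_limit[OF open_X assms v(1)])
    then obtain j where "j \<in> active x" "v \<bullet> (- a) \<le> gradient (gs j) x \<bullet> (- a)"
      using finite_active active_nonempty[OF assms] by (subst (asm) Max_ge_iff) auto
    then show False
      using ab(1) ab(2)[of "gradient (gs j) x"] by (auto simp: hull_inc inner_commute)
  qed
qed

section \<open>The equality and the inclusion\<close>

lemma UN_D_family_eq_UN_Arg_max_set:
  assumes "x \<in> X"
  shows "(\<Union>D\<in>D_family J gs g x. convex hull ((\<lambda>j. gradient (gs j) x) ` D)) =
    (\<Union>p\<in>{p \<in> sphere 0 1. hadamard_deriv g x p > 0}. Arg_max_set (\<lambda>v. v \<bullet> p) (frechet_subdiff X g x))"
    (is "?L = ?R")
proof
  let ?a = "\<lambda>j. gradient (gs j) x"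
  show "?L \<subseteq> ?R"
  proof
    fix v
    assume "v \<in> ?L"
    then obtain D d where D: "D \<subseteq> active x" and d: "\<And>j. j \<in> D \<Longrightarrow> ?a j \<bullet> d = 1"
      "\<And>j. j \<in> active x - D \<Longrightarrow> ?a j \<bullet> d < 1" and v: "v \<in> convex hull (?a ` D)"
      unfolding D_family_def by blast
    \<comment> \<open>An empty \<open>D\<close> contributes the empty hull, so \<open>D\<close> has
      an element here; this forces \<open>d\<close> to be nonzero.\<close>
    obtain i where i: "i \<in> D"
      using v by (cases "D = {}") auto
    have "d \<noteq> 0"
      using d(1)[OF i] by auto
    define p where "p = d /\<^sub>R norm d"
    \<comment> \<open>Normalising \<open>d\<close> turns the common value 1 into \<open>m\<close>,
      which is then the derivative of \<open>g\<close> along \<open>p\<close>.\<close>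
    define m where "m = inverse (norm d)"
    have "m > 0"
      using \<open>d \<noteq> 0\<close> by (simp add: m_def)
    have ap: "?a j \<bullet> p = m * (?a j \<bullet> d)" for j
      by (simp add: p_def m_def)
    have eq: "?a j \<bullet> p = m" if "j \<in> D" for j
      using d(1)[OF that] ap by simp
    have less: "?a j \<bullet> p < m" if "j \<in> active x - D" for j
      using d(2)[OF that] ap \<open>m > 0\<close> by simp
    have le: "?a j \<bullet> p \<le> m" if "j \<in> active x" for j
      using eq less that by (cases "j \<in> D") (auto intro: less_imp_le)
    have "Max ((\<lambda>j. ?a j \<bullet> p) ` active x) = m"
      using finite_active le eq[OF i, symmetric] i D by (intro Max_eqI) auto
    then have "hadamard_deriv g x p > 0"
      using \<open>m > 0\<close> by (simp add: hadamard_deriv_eq_Max assms)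
    moreover have "p \<in> sphere 0 1"
      using \<open>d \<noteq> 0\<close> by (simp add: p_def)
    moreover have "Arg_max_set (\<lambda>v. v \<bullet> p) (frechet_subdiff X g x) = convex hull (?a ` {j \<in> active x. ?a j \<bullet> p = m})"
      unfolding frechet_subdiff_eq_convex_hull[OF assms]
      using finite_active le eq i D by (intro Arg_max_set_convex_hull) blast+
    moreover have "{j \<in> active x. ?a j \<bullet> p = m} = D"
      using eq less D by force
    ultimately show "v \<in> ?R"
      using v by auto
  qed
  show "?R \<subseteq> ?L"
  proof
    fix v
    assume "v \<in> ?R"
    then obtain p where p: "hadamard_deriv g x p > 0"
      and v: "v \<in> Arg_max_set (\<lambda>v. v \<bullet> p) (frechet_subdiff X g x)"
      by blast
    define m where "m = Max ((\<lambda>j. ?a j \<bullet> p) ` active x)"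
    define D where "D = {j \<in> active x. ?a j \<bullet> p = m}"
    have "m > 0"
      using p by (simp add: m_def hadamard_deriv_eq_Max assms)
    have le: "?a j \<bullet> p \<le> m" if "j \<in> active x" for j
      unfolding m_def using finite_active that by simp
    have "m \<in> (\<lambda>j. ?a j \<bullet> p) ` active x"
      unfolding m_def using finite_active active_nonempty[OF assms] by (intro Max_in) auto
    then have "v \<in> convex hull (?a ` D)"
      using v unfolding frechet_subdiff_eq_convex_hull[OF assms] D_def
      by (subst (asm) Arg_max_set_convex_hull[where m = m]) (use finite_active le in auto)
    moreover have "D \<in> D_family J gs g x"
      unfolding D_family_def
    \<comment> \<open>The inverse rescaling: dividing by the derivative \<open>m\<close> brings the
      maximal value back to 1.\<close>
    proof (intro CollectI conjI exI[of _ "p /\<^sub>R m"] ballI)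
      show "D \<subseteq> active x"
        by (auto simp: D_def)
      show "?a j \<bullet> (p /\<^sub>R m) = 1" if "j \<in> D" for j
        using that \<open>m > 0\<close> by (simp add: D_def)
      show "?a j \<bullet> (p /\<^sub>R m) < 1" if "j \<in> active x - D" for j
      proof -
        have "?a j \<bullet> p < m"
          using that le[of j] by (auto simp: D_def)
        then show ?thesis
          using \<open>m > 0\<close> by (simp add: field_simps)
      qed
    qed
    ultimately show "v \<in> ?L"
      by blast
  qed
qed

text \<open>A maximiser \<open>y\<close> dominates all active gradients along \<open>p\<close>,
  while no subgradient exceeds the derivative. Hence \<open>y \<bullet> p\<close> equals the
  derivative, which is the tightness required for the penalty argument.\<close>

lemma UN_Arg_max_set_subset_outer_limit:
  assumes "x \<in> X"
  shows "(\<Union>p\<in>{p \<in> sphere 0 1. hadamard_deriv g x p > 0}. Arg_max_set (\<lambda>v. v \<bullet> p) (frechet_subdiff X g x))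
    \<subseteq> outer_limit_subdiff X g x"
proof
  let ?a = "\<lambda>j. gradient (gs j) x"
  fix y
  assume "y \<in> (\<Union>p\<in>{p \<in> sphere 0 1. hadamard_deriv g x p > 0}. Arg_max_set (\<lambda>v. v \<bullet> p) (frechet_subdiff X g x))"
  then obtain p where p: "hadamard_deriv g x p > 0"
    and y: "y \<in> frechet_subdiff X g x" and ymax: "\<And>v. v \<in> frechet_subdiff X g x \<Longrightarrow> v \<bullet> p \<le> y \<bullet> p"
    unfolding Arg_max_set_def is_arg_max_def by force
  let ?m = "Max ((\<lambda>j. ?a j \<bullet> p) ` active x)"
  have "y \<bullet> p \<le> ?m"
    by (rule frechet_subgradient_le_hadamard_limit[OF open_X assms y hadamard_quotient_tendsto[OF assms]])
  moreover have "?m \<le> y \<bullet> p"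
    using finite_active active_nonempty[OF assms] ymax
    by (auto simp: frechet_subdiff_eq_convex_hull assms hull_inc)
  ultimately have m: "?m = y \<bullet> p"
    by simp
  show "y \<in> outer_limit_subdiff X g x"
  proof (rule tight_subgradient_in_outer_limit[OF open_X assms _ y])
    show "continuous_on X g"
      by (simp add: continuous_at_imp_continuous_on isCont_g)
    show "((\<lambda>u. (g (x + fst u *\<^sub>R snd u) - g x) / fst u) \<longlongrightarrow> y \<bullet> p) (at_right 0 \<times>\<^sub>F nhds p)"
      using hadamard_quotient_tendsto[OF assms, of p] unfolding m .
    show "y \<bullet> p > 0"
      using p m by (simp add: hadamard_deriv_eq_Max assms)
  qed
qed

section \<open>The affine case\<close>

text \<open>A single linear part serves all of \<open>X\<close>, so the gradient agrees even between
  different components of \<open>X\<close>.\<close>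

lemma affine_gradient:
  assumes "affine_fun_on X (gs j)" "j \<in> J" "x \<in> X" "z \<in> X"
  shows "gradient (gs j) z = gradient (gs j) x" "gs j z = gs j x + gradient (gs j) x \<bullet> (z - x)"
proof -
  obtain L c where L: "linear L" and eq: "\<And>w. w \<in> X \<Longrightarrow> gs j w = L w + c"
    using assms unfolding affine_fun_on_def by blast
  have grad: "gradient (gs j) w \<bullet> h = L h" if "w \<in> X" for w h
  proof -
    have "((\<lambda>w. L w + c) has_derivative L) (at w)"
      using L by (auto intro!: derivative_eq_intros bounded_linear_imp_has_derivative
          simp: linear_conv_bounded_linear)
    then have "(gs j has_derivative L) (at w)"
      by (rule has_derivative_transform_within_open[OF _ open_X that]) (simp add: eq)
    moreover have "(gs j has_derivative (\<lambda>h. h \<bullet> gradient (gs j) w)) (at w)"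
      using GDERIV_gs[OF \<open>j \<in> J\<close> that] by (simp add: gderiv_def)
    ultimately show ?thesis
      using has_derivative_unique by (metis inner_commute)
  qed
  show "gradient (gs j) z = gradient (gs j) x"
    using grad assms by (metis vector_eq_ldot inner_commute)
  show "gs j z = gs j x + gradient (gs j) x \<bullet> (z - x)"
    using grad assms eq L by (simp add: linear_diff)
qed

lemma affine_outer_limit_subset:
  assumes aff: "\<forall>j\<in>J. affine_fun_on X (gs j)" and x: "x \<in> X"
  shows "outer_limit_subdiff X g x \<subseteq> (\<Union>D\<in>D_family J gs g x. convex hull ((\<lambda>j. gradient (gs j) x) ` D))"
    (is "_ \<subseteq> ?L")
proof
  let ?a = "\<lambda>j. gradient (gs j) x"
  fix y
  assume "y \<in> outer_limit_subdiff X g x"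
  then obtain xs ys where xs: "\<And>k::nat. xs k \<in> X" "\<And>k. g (xs k) > g x" "xs \<longlonglongrightarrow> x"
    and ys: "\<And>k. ys k \<in> frechet_subdiff X g (xs k)" "ys \<longlonglongrightarrow> y"
    unfolding outer_limit_subdiff_def by blast
  have D_subset: "D_family J gs g x \<subseteq> Pow (active x)"
    by (auto simp: D_family_def)
  have "closed ?L"
  proof (rule closed_UN)
    show "finite (D_family J gs g x)"
      using D_subset by (rule finite_subset) (simp add: finite_active)
    show "\<forall>D\<in>D_family J gs g x. closed (convex hull (?a ` D))"
    proof
      fix D
      assume "D \<in> D_family J gs g x"
      then have "D \<subseteq> active x"
        using D_subset by blast
      then have "finite D"
        using finite_active by (rule finite_subset)
      then show "closed (convex hull (?a ` D))"
        by (intro compact_imp_closed finite_imp_compact_convex_hull finite_imageI)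
    qed
  qed
  \<comment> \<open>Membership holds only from some \<open>k\<close> on, once
    \<open>active (xs k)\<close> is contained in \<open>active x\<close>; closedness then transfers
    it to \<open>y\<close>.\<close>
  moreover have "\<forall>\<^sub>F k in sequentially. ys k \<in> ?L"
    using eventually_compose_filterlim[OF eventually_active_subset[OF x] xs(3)]
  proof eventually_elim
    case (elim k)
    define s where "s = g (xs k) - g x"
    have "s > 0"
      using xs by (simp add: s_def)
    have val: "gs j (xs k) = g x + ?a j \<bullet> (xs k - x)" if "j \<in> active x" for j
      using affine_gradient(2)[of j x "xs k"] aff that x xs(1) by (auto simp: active_set_def)
    have "active (xs k) \<in> D_family J gs g x"
      unfolding D_family_def
    proof (intro CollectI conjI exI[of _ "(xs k - x) /\<^sub>R s"] ballI)
      show "active (xs k) \<subseteq> active x"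
        by (rule elim)
      show "?a j \<bullet> ((xs k - x) /\<^sub>R s) = 1" if "j \<in> active (xs k)" for j
      proof -
        have "?a j \<bullet> (xs k - x) = s"
          using val[of j] elim that by (auto simp: active_set_def s_def)
        then show ?thesis
          using \<open>s > 0\<close> by simp
      qed
      show "?a j \<bullet> ((xs k - x) /\<^sub>R s) < 1" if "j \<in> active x - active (xs k)" for j
      proof -
        have "gs j (xs k) < g (xs k)"
          using that gs_le_g[of j "xs k"] xs(1) by (force simp: active_set_def)
        then have "?a j \<bullet> (xs k - x) < s"
          using val[of j] that by (simp add: s_def)
        then show ?thesis
          unfolding inner_scaleR_right using \<open>s > 0\<close> by (simp add: field_simps)
      qed
    qed
    \<comment> \<open>Since gradients are constant, the subdifferential at \<open>xs k\<close> is a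
      hull of gradients taken at \<open>x\<close>.\<close>
    moreover have "(\<lambda>j. gradient (gs j) (xs k)) ` active (xs k) = ?a ` active (xs k)"
      using affine_gradient(1) aff x xs(1) active_subset by (intro image_cong refl) blast
    ultimately show ?case
      using ys(1)[of k] by (auto simp: frechet_subdiff_eq_convex_hull xs(1))
  qed
  ultimately show "y \<in> ?L"
    using ys(2) by (intro Lim_in_closed_set[of ?L ys sequentially]) auto
qed

end

theorem corollary3:
  fixes X :: "(real ^ 'n) set"
    and xbar :: "real ^ 'n"
    and J :: "'i set"
    and gs :: "'i \<Rightarrow> real ^ 'n \<Rightarrow> real"
    and g :: "real ^ 'n \<Rightarrow> real"
  assumes "open X"
    and "xbar \<in> X"
    and "finite J"
    and "J \<noteq> {}"
    and "\<And>x. x \<in> X \<Longrightarrow> g x = Max ((\<lambda>j. gs j x) ` J)"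
    and "\<And>j. j \<in> J \<Longrightarrow> C1_on X (gs j)"
  shows "(\<Union>D\<in>D_family J gs g xbar. convex hull ((\<lambda>j. gradient (gs j) xbar) ` D)) =
           (\<Union>p\<in>{p \<in> sphere 0 1. hadamard_deriv g xbar p > 0}.
              Arg_max_set (\<lambda>v. v \<bullet> p) (frechet_subdiff X g xbar))
       \<and> (\<Union>p\<in>{p \<in> sphere 0 1. hadamard_deriv g xbar p > 0}.
              Arg_max_set (\<lambda>v. v \<bullet> p) (frechet_subdiff X g xbar))
           \<subseteq> outer_limit_subdiff X g xbar
       \<and> ((\<forall>j\<in>J. affine_fun_on X (gs j)) \<longrightarrow>
            (\<Union>p\<in>{p \<in> sphere 0 1. hadamard_deriv g xbar p > 0}.
              Arg_max_set (\<lambda>v. v \<bullet> p) (frechet_subdiff X g xbar))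
           = outer_limit_subdiff X g xbar)"
proof -
  interpret max_function X J gs g
    using assms by unfold_locales (auto simp: C1_on_def)
  note eq = UN_D_family_eq_UN_Arg_max_set[OF \<open>xbar \<in> X\<close>]
  note sub = UN_Arg_max_set_subset_outer_limit[OF \<open>xbar \<in> X\<close>]
  have "outer_limit_subdiff X g xbar \<subseteq>
      (\<Union>p\<in>{p \<in> sphere 0 1. hadamard_deriv g xbar p > 0}.
        Arg_max_set (\<lambda>v. v \<bullet> p) (frechet_subdiff X g xbar))"
    if "\<forall>j\<in>J. affine_fun_on X (gs j)"
    using affine_outer_limit_subset[OF that \<open>xbar \<in> X\<close>] unfolding eq .
  with eq sub show ?thesis
    by (metis (no_types, lifting) subset_antisym)
qed

end
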